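(* For any permutation $\pi\in\mathcal S_n(132)$ consider the associated Dyck path $\Psi_K(\pi)$ of length $2n$ and denote by $w_i(\pi)$ the height of the starting point of its $i$th step. Then: (a) $w_1(\pi)+\dots+w_{2n}(\pi)=n^2-2\,\mathrm{inv}(\pi)$. (b) $w_{i_1}(\pi)+\dots+w_{i_s}(\pi)=\binom{n+1}{2}-\mathrm{inv}(\pi)$, where $i_1,\dots,i_s$ are the indices of the down-steps of $\Psi_K(\pi)$.
   Context: $\mathcal S_n(132)$ is the set of permutations $\pi=\pi_1\cdots\pi_n$ of $\{1,\dots,n\}$ avoiding the pattern $132$ (no $i<j<k$ with $\pi_i<\pi_k<\pi_j$). $\mathrm{inv}(\pi)$ is the number of inversions, i.e. pairs $i<j$ with $\pi_i>\pi_j$. A Dyck path of length $2n$ is a lattice path from $(0,0)$ to $(2n,0)$ with up-steps $[1,1]$ and down-steps $[1,-1]$ never falling below the $x$-axis; the height of a point is its $y$-coordinate. $\Psi_K$ (Krattenthaler's bijection from $\mathcal S_n(132)$ to Dyck paths of length $2n$): for $\sigma\in\mathcal S_n(132)$ let $c_1>\dots>c_m$ be the left-to-right minima of $\sigma$ (elements $\sigma_i$ with $\sigma_i<\sigma_j$ for all $j<i$), in order of appearance, and $c_0:=n+1$. Let $d_k$ be one plus the number of letters of $\sigma$ strictly between $c_k$ and $c_{k+1}$ (for $k=m$: one plus the number of letters after $c_m$). The path starts at the origin and is generated by adjoining, successively for $k=1,\dots,m$, $c_{k-1}-c_k$ up-steps followed by $d_k$ down-steps. *)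

theory Defs
  imports "HOL-Combinatorics.Multiset_Permutations"
begin

text \<open>
  Permutations of \<open>{1..n}\<close> are lists in one-line notation. The letter \<open>\<pi>\<^sub>i\<close> is \<open>\<pi> ! (i - 1)\<close>,
  so pairs and triples of positions below range over 0-based list indices.
\<close>

definition avoids_132 :: "nat list \<Rightarrow> bool" where
  "avoids_132 \<pi> \<longleftrightarrow>
     \<not> (\<exists>i j k. i < j \<and> j < k \<and> k < length \<pi> \<and> \<pi> ! i < \<pi> ! k \<and> \<pi> ! k < \<pi> ! j)"

definition S132 :: "nat \<Rightarrow> nat list set" where
  "S132 n = {\<pi> \<in> permutations_of_set {1..n}. avoids_132 \<pi>}"

definition inv_count :: "nat list \<Rightarrow> nat" where
  "inv_count \<pi> = card {(i, j). i < j \<and> j < length \<pi> \<and> \<pi> ! i > \<pi> ! j}"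

datatype step = Up | Down

primrec step_rise :: "step \<Rightarrow> int" where
  "step_rise Up = 1"
| "step_rise Down = - 1"

text \<open>A lattice path starting at the origin is its list of steps.\<close>

text \<open>The height of the point reached after \<open>k\<close> steps.\<close>

definition point_height :: "step list \<Rightarrow> nat \<Rightarrow> int" where
  "point_height p k = (\<Sum>s\<leftarrow>take k p. step_rise s)"

text \<open>
  The \<open>i\<close>th step, with \<open>1 \<le> i \<le> length p\<close>, is \<open>p ! (i - 1)\<close>; it starts at the point reached
  after \<open>i - 1\<close> steps.
\<close>

definition start_height :: "step list \<Rightarrow> nat \<Rightarrow> int" where
  "start_height p i = point_height p (i - 1)"

definition down_indices :: "step list \<Rightarrow> nat set" where
  "down_indices p = {i \<in> {1..length p}. p ! (i - 1) = Down}"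

definition lr_min_positions :: "nat list \<Rightarrow> nat list" where
  "lr_min_positions \<sigma> = filter (\<lambda>i. \<forall>j<i. \<sigma> ! i < \<sigma> ! j) [0..<length \<sigma>]"

text \<open>\<open>lr_min \<sigma> k\<close> is \<open>c\<^sub>k\<close> for \<open>0 \<le> k \<le> m\<close>, where \<open>m = length (lr_min_positions \<sigma>)\<close>.\<close>

definition lr_min :: "nat list \<Rightarrow> nat \<Rightarrow> nat" where
  "lr_min \<sigma> k = (if k = 0 then length \<sigma> + 1 else \<sigma> ! (lr_min_positions \<sigma> ! (k - 1)))"

text \<open>
  \<open>gap \<sigma> k\<close> is \<open>d\<^sub>k\<close> for \<open>1 \<le> k \<le> m\<close>: the list positions of \<open>c\<^sub>k\<close> and \<open>c\<^bsub>k+1\<^esub>\<close> are the entries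
  \<open>k - 1\<close> and \<open>k\<close> of \<open>lr_min_positions \<sigma>\<close>, and the letters between them are counted by position.
\<close>

definition gap :: "nat list \<Rightarrow> nat \<Rightarrow> nat" where
  "gap \<sigma> k =
     (let P = lr_min_positions \<sigma> in
      1 + card {i. P ! (k - 1) < i \<and> i < (if k < length P then P ! k else length \<sigma>)})"

text \<open>The natural-number subtraction is exact, since the left-to-right minima decrease.\<close>

definition Psi_K :: "nat list \<Rightarrow> step list" where
  "Psi_K \<sigma> =
     concat (map (\<lambda>k. replicate (lr_min \<sigma> (k - 1) - lr_min \<sigma> k) Up @ replicate (gap \<sigma> k) Down)
       [1..<Suc (length (lr_min_positions \<sigma>))])"

end

theory Submission
  imports Defs
begin

text \<open>
  Down-steps of \<open>Psi_K \<sigma>\<close> correspond to the letters of \<open>\<sigma>\<close> in order. A block of the path puts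
  \<open>c\<^bsub>k-1\<^esub> - c\<^sub>k\<close> up-steps before the down-steps of the letters from \<open>c\<^sub>k\<close> up to the letter before
  \<open>c\<^bsub>k+1\<^esub>\<close>, so the up-steps telescope: when the down-step of the letter at position \<open>j\<close> starts,
  \<open>j\<close> down-steps and \<open>n + 1 - \<mu>\<close> up-steps have been made, \<open>\<mu>\<close> being the minimum of the letters up to
  position \<open>j\<close> (lemma \<open>Psi_K_profile\<close>). Hence this step starts at height \<open>n + 1 - \<mu> - j\<close>.

  All \<open>j\<close> letters before position \<open>j\<close> are at least \<open>\<mu>\<close>, so this height counts the letters from
  position \<open>j\<close> on that are at least \<open>\<mu>\<close>. A later letter strictly between \<open>\<mu>\<close> and \<open>\<sigma> ! j\<close> would
  complete a pattern 132 with these two. The height is therefore one plus the number of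
  non-inversions with left end \<open>j\<close>, that is, \<open>n - j\<close> minus the number of inversions with left end
  \<open>j\<close> (lemma \<open>height_eq_noninversions\<close>). Summing over \<open>j\<close> gives the second identity.

  The first identity follows from the second. Along any path the square of the height changes by
  \<open>2h + 1\<close> on an up-step and by \<open>1 - 2h\<close> on a down-step that starts at height \<open>h\<close>; these changes
  add up to zero on a path that returns to the axis. This expresses the sum of all heights by the
  sum over the down-steps and the length (lemma \<open>end_height_square\<close>).
\<close>

section \<open>Heights along a lattice path\<close>

definition end_height :: "step list \<Rightarrow> int" where
  "end_height p = point_height p (length p)"

definition height_sum :: "step list \<Rightarrow> int" where
  "height_sum p = (\<Sum>i=1..length p. start_height p i)"

definition down_height_sum :: "step list \<Rightarrow> int" where
  "down_height_sum p = (\<Sum>i\<in>down_indices p. start_height p i)"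

lemma end_height_Nil [simp]: "end_height [] = 0"
  by (simp add: end_height_def point_height_def)

lemma end_height_snoc [simp]: "end_height (p @ [s]) = end_height p + step_rise s"
  by (simp add: end_height_def point_height_def)

lemma start_height_snoc: "i \<le> Suc (length p) \<Longrightarrow>
    start_height (p @ [s]) i = (if i = Suc (length p) then end_height p else start_height p i)"
  by (auto simp: start_height_def end_height_def point_height_def)

lemma height_sum_Nil [simp]: "height_sum [] = 0"
  by (simp add: height_sum_def)

lemma height_sum_snoc [simp]: "height_sum (p @ [s]) = height_sum p + end_height p"
proof -
  have "(\<Sum>i=1..length p. start_height (p @ [s]) i) = (\<Sum>i=1..length p. start_height p i)"
    by (rule sum.cong) (auto simp: start_height_snoc)
  then show ?thesis
    by (simp add: height_sum_def start_height_snoc)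
qed

lemma down_indices_snoc: "down_indices (p @ [s]) =
    down_indices p \<union> (if s = Down then {Suc (length p)} else {})"
  by (auto simp: down_indices_def nth_append le_Suc_eq split: if_splits)

lemma down_height_sum_Nil [simp]: "down_height_sum [] = 0"
  by (simp add: down_height_sum_def down_indices_def)

lemma down_height_sum_snoc [simp]: "down_height_sum (p @ [s]) =
    down_height_sum p + (if s = Down then end_height p else 0)"
proof -
  have old: "(\<Sum>i\<in>down_indices p. start_height (p @ [s]) i) = down_height_sum p"
    unfolding down_height_sum_def
    by (rule sum.cong) (auto simp: start_height_snoc down_indices_def)
  have fin: "finite (down_indices p)" and new: "Suc (length p) \<notin> down_indices p"
    by (auto simp: down_indices_def)
  show ?thesis
  proof (cases "s = Down")
    case True
    then have "down_height_sum (p @ [s])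
        = start_height (p @ [s]) (Suc (length p)) + (\<Sum>i\<in>down_indices p. start_height (p @ [s]) i)"
      using fin new by (simp add: down_height_sum_def down_indices_snoc)
    then show ?thesis
      unfolding old using True by (simp add: start_height_snoc)
  next
    case False
    then have "down_height_sum (p @ [s]) = (\<Sum>i\<in>down_indices p. start_height (p @ [s]) i)"
      by (simp add: down_height_sum_def down_indices_snoc)
    then show ?thesis
      unfolding old using False by simp
  qed
qed

text \<open>This telescopes the increments \<open>(h + 1)\<^sup>2 - h\<^sup>2\<close> and \<open>(h - 1)\<^sup>2 - h\<^sup>2\<close> of the squared height.\<close>

lemma end_height_square:
  "(end_height p)\<^sup>2 = 2 * height_sum p - 4 * down_height_sum p + int (length p)"
proof (induction p rule: rev_induct)
  case (snoc s p)
  then show ?case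
    by (cases s) (simp_all add: power2_eq_square algebra_simps)
qed simp

lemma replicate_Suc_snoc: "p @ replicate (Suc a) x = (p @ replicate a x) @ [x]"
  by (simp add: replicate_append_same)

lemma end_height_Ups: "end_height (p @ replicate a Up) = end_height p + int a"
proof (induction a)
  case (Suc a)
  then show ?case
    by (simp only: replicate_Suc_snoc end_height_snoc) simp
qed simp

lemma down_height_sum_Ups: "down_height_sum (p @ replicate a Up) = down_height_sum p"
proof (induction a)
  case (Suc a)
  then show ?case
    by (simp only: replicate_Suc_snoc down_height_sum_snoc) simp
qed simp

lemma end_height_Downs: "end_height (p @ replicate d Down) = end_height p - int d"
proof (induction d)
  case (Suc d)
  then show ?case
    by (simp only: replicate_Suc_snoc end_height_snoc) simp
qed simp

lemma down_height_sum_Downs: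
  "down_height_sum (p @ replicate d Down) = down_height_sum p + (\<Sum>t<d. end_height p - int t)"
proof (induction d)
  case (Suc d)
  then show ?case
    by (simp only: replicate_Suc_snoc down_height_sum_snoc end_height_Downs) simp
qed simp

section \<open>Left-to-right minima\<close>

definition prefix_min :: "nat list \<Rightarrow> nat \<Rightarrow> nat" where
  "prefix_min \<sigma> j = Min (set (take (Suc j) \<sigma>))"

lemma prefix_min_le: "i \<le> j \<Longrightarrow> j < length \<sigma> \<Longrightarrow> prefix_min \<sigma> j \<le> \<sigma> ! i"
  unfolding prefix_min_def by (rule Min_le) (auto simp: in_set_conv_nth intro!: exI [of _ i])

lemma prefix_min_attained:
  assumes "j < length \<sigma>"
  obtains i where "i \<le> j" "\<sigma> ! i = prefix_min \<sigma> j"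
proof -
  have "prefix_min \<sigma> j \<in> set (take (Suc j) \<sigma>)"
    unfolding prefix_min_def using assms by (intro Min_in) auto
  then show thesis
    using that by (auto simp: in_set_conv_nth less_Suc_eq_le)
qed

text \<open>
  \<open>block_start \<sigma> k\<close> is the list position of \<open>c\<^bsub>k+1\<^esub>\<close>. With the position past the last letter for
  \<open>k = m\<close>, it is also the number of down-steps in the first \<open>k\<close> blocks for every \<open>k \<le> m\<close>.
\<close>

definition block_start :: "nat list \<Rightarrow> nat \<Rightarrow> nat" where
  "block_start \<sigma> k = (if k < length (lr_min_positions \<sigma>) then lr_min_positions \<sigma> ! k else length \<sigma>)"

lemma set_lr_min_positions:
  "set (lr_min_positions \<sigma>) = {i. i < length \<sigma> \<and> (\<forall>j<i. \<sigma> ! i < \<sigma> ! j)}"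
  by (auto simp: lr_min_positions_def)

lemma lr_min_positions_nth:
  assumes "k < length (lr_min_positions \<sigma>)"
  shows "lr_min_positions \<sigma> ! k < length \<sigma>"
    and "\<And>j. j < lr_min_positions \<sigma> ! k \<Longrightarrow> \<sigma> ! (lr_min_positions \<sigma> ! k) < \<sigma> ! j"
  using nth_mem [OF assms] by (auto simp: set_lr_min_positions)

lemma strict_sorted_lr_min_positions: "sorted_wrt (<) (lr_min_positions \<sigma>)"
  unfolding lr_min_positions_def by (intro sorted_wrt_filter) simp

lemma block_start_0: "block_start \<sigma> 0 = 0"
proof (cases "\<sigma> = []")
  case False
  then have "0 \<in> set (lr_min_positions \<sigma>)"
    by (simp add: set_lr_min_positions)
  then obtain k where k: "k < length (lr_min_positions \<sigma>)" "lr_min_positions \<sigma> ! k = 0"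
    by (auto simp: in_set_conv_nth)
  have "k = 0"
    using sorted_wrt_nth_less [OF strict_sorted_lr_min_positions, of 0 k \<sigma>] k by (cases k) auto
  with k show ?thesis
    by (simp add: block_start_def)
qed (simp add: block_start_def lr_min_positions_def)

lemma block_start_less:
  assumes "k < length (lr_min_positions \<sigma>)"
  shows "block_start \<sigma> k < block_start \<sigma> (Suc k)"
  using assms sorted_wrt_nth_less [OF strict_sorted_lr_min_positions, of k "Suc k" \<sigma>]
    lr_min_positions_nth(1) [OF assms]
  by (auto simp: block_start_def)

lemma gap_eq:
  assumes "k < length (lr_min_positions \<sigma>)"
  shows "gap \<sigma> (Suc k) = block_start \<sigma> (Suc k) - block_start \<sigma> k"
proof -
  have "gap \<sigma> (Suc k) = 1 + card {block_start \<sigma> k<..<block_start \<sigma> (Suc k)}"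
    using assms
    by (simp add: gap_def Let_def block_start_def greaterThanLessThan_def
        greaterThan_def lessThan_def Int_def)
  then show ?thesis
    using block_start_less [OF assms] by simp
qed

text \<open>
  In a word without repetitions the minimum of a prefix is attained only once, hence at a
  left-to-right minimum, and it is the last one in that prefix, as these minima decrease.
\<close>

lemma prefix_min_in_block:
  assumes dist: "distinct \<sigma>" and k: "k < length (lr_min_positions \<sigma>)"
    and j: "block_start \<sigma> k \<le> j" "j < block_start \<sigma> (Suc k)"
  shows "prefix_min \<sigma> j = lr_min \<sigma> (Suc k)"
proof -
  let ?P = "lr_min_positions \<sigma>"
  have jn: "j < length \<sigma>"
    using j(2) lr_min_positions_nth(1) [of "Suc k" \<sigma>]
    by (auto simp: block_start_def split: if_splits)
  obtain i where i: "i \<le> j" "\<sigma> ! i = prefix_min \<sigma> j"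
    using prefix_min_attained [OF jn] .
  have "\<sigma> ! i < \<sigma> ! l" if "l < i" for l
    using prefix_min_le [of l j \<sigma>] that i jn nth_eq_iff_index_eq [OF dist, of i l] by force
  then have "i \<in> set ?P"
    using i jn by (auto simp: set_lr_min_positions)
  then obtain q where q: "q < length ?P" "?P ! q = i"
    by (auto simp: in_set_conv_nth)
  have "\<not> k < q"
  proof
    assume "k < q"
    then have "?P ! Suc k \<le> ?P ! q"
      using sorted_wrt_nth_less [OF strict_sorted_lr_min_positions, of "Suc k" q \<sigma>] q
      by (cases "q = Suc k") auto
    with j q i \<open>k < q\<close> show False
      by (simp add: block_start_def)
  qed
  moreover have "\<not> q < k"
  proof
    assume "q < k"
    then have "?P ! q < ?P ! k"
      using sorted_wrt_nth_less [OF strict_sorted_lr_min_positions, of q k \<sigma>] k by simp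
    then have "\<sigma> ! (?P ! k) < prefix_min \<sigma> j"
      using lr_min_positions_nth(2) [OF k, of i] q i by simp
    moreover have "prefix_min \<sigma> j \<le> \<sigma> ! (?P ! k)"
      using prefix_min_le [of "?P ! k" j \<sigma>] j jn k by (simp add: block_start_def)
    ultimately show False by simp
  qed
  ultimately have "q = k" by simp
  with q i show ?thesis
    by (simp add: lr_min_def)
qed

section \<open>The profile of the path of a permutation\<close>

lemma lr_min_decreasing:
  assumes \<sigma>: "set \<sigma> = {1..length \<sigma>}" and k: "k < length (lr_min_positions \<sigma>)"
  shows "lr_min \<sigma> (Suc k) \<le> lr_min \<sigma> k"
proof (cases k)
  case 0
  then show ?thesis
    using \<sigma> nth_mem [OF lr_min_positions_nth(1) [OF k]] by (simp add: lr_min_def)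
next
  case (Suc l)
  then have "lr_min_positions \<sigma> ! l < lr_min_positions \<sigma> ! k"
    using sorted_wrt_nth_less [OF strict_sorted_lr_min_positions, of l k \<sigma>] k by simp
  then show ?thesis
    using lr_min_positions_nth(2) [OF k] Suc by (simp add: lr_min_def less_imp_le)
qed

lemma lr_min_last:
  assumes \<sigma>: "set \<sigma> = {1..length \<sigma>}" "distinct \<sigma>"
  shows "lr_min \<sigma> (length (lr_min_positions \<sigma>)) = 1"
proof (cases "\<sigma> = []")
  case False
  let ?m = "length (lr_min_positions \<sigma>)"
  have m: "?m > 0"
    using False block_start_0 [of \<sigma>] by (cases ?m) (auto simp: block_start_def)
  then obtain k where k: "?m = Suc k"
    by (cases ?m) auto
  let ?j = "length \<sigma> - 1"
  have "prefix_min \<sigma> ?j = lr_min \<sigma> (Suc k)"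
    using block_start_less [of k \<sigma>] k False
    by (intro prefix_min_in_block [OF \<sigma>(2)]) (auto simp: block_start_def)
  moreover have "prefix_min \<sigma> ?j = Min {1..length \<sigma>}"
    using \<sigma>(1) False by (simp add: prefix_min_def)
  moreover have "Min {1..length \<sigma>} = 1"
    using False by (intro Min_eqI) (auto simp: Suc_le_eq)
  ultimately show ?thesis
    using k by simp
qed (simp add: lr_min_def lr_min_positions_def)

definition path_blocks :: "nat list \<Rightarrow> nat \<Rightarrow> step list" where
  "path_blocks \<sigma> k =
     concat (map (\<lambda>k. replicate (lr_min \<sigma> (k - 1) - lr_min \<sigma> k) Up @ replicate (gap \<sigma> k) Down)
       [1..<Suc k])"

lemma path_blocks_0: "path_blocks \<sigma> 0 = []"
  by (simp add: path_blocks_def)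

lemma path_blocks_Suc: "path_blocks \<sigma> (Suc k) =
    (path_blocks \<sigma> k @ replicate (lr_min \<sigma> k - lr_min \<sigma> (Suc k)) Up)
      @ replicate (gap \<sigma> (Suc k)) Down"
  by (simp add: path_blocks_def)

text \<open>
  After \<open>k\<close> blocks there are \<open>n + 1 - c\<^sub>k\<close> up-steps, by telescoping, and one down-step for each
  letter before \<open>c\<^bsub>k+1\<^esub>\<close>. Within a block the minimum of the letters read so far is constant, so
  its down-steps contribute their heights to the sum on the right.
\<close>

lemma path_blocks_profile:
  assumes \<sigma>: "set \<sigma> = {1..length \<sigma>}" "distinct \<sigma>" and k: "k \<le> length (lr_min_positions \<sigma>)"
  shows "int (length (path_blocks \<sigma> k))
           = int (length \<sigma>) + 1 - int (lr_min \<sigma> k) + int (block_start \<sigma> k)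
       \<and> end_height (path_blocks \<sigma> k)
           = int (length \<sigma>) + 1 - int (lr_min \<sigma> k) - int (block_start \<sigma> k)
       \<and> down_height_sum (path_blocks \<sigma> k)
           = (\<Sum>j<block_start \<sigma> k. int (length \<sigma>) + 1 - int (prefix_min \<sigma> j) - int j)"
  using k
proof (induction k)
  case 0
  show ?case
    by (simp add: path_blocks_0 block_start_0 lr_min_def)
next
  case (Suc k)
  let ?f = "\<lambda>j. int (length \<sigma>) + 1 - int (prefix_min \<sigma> j) - int j"
  let ?a = "block_start \<sigma> k" and ?b = "block_start \<sigma> (Suc k)"
  let ?q = "path_blocks \<sigma> k @ replicate (lr_min \<sigma> k - lr_min \<sigma> (Suc k)) Up"
  have k: "k < length (lr_min_positions \<sigma>)"
    using Suc.prems by simp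
  note IH = Suc.IH [OF less_imp_le [OF k]]
  note lt = block_start_less [OF k] and gap = gap_eq [OF k] and dec = lr_min_decreasing [OF \<sigma>(1) k]
  have top: "end_height ?q = int (length \<sigma>) + 1 - int (lr_min \<sigma> (Suc k)) - int ?a"
    using IH dec by (simp add: end_height_Ups of_nat_diff)
  have "(\<Sum>t<?b - ?a. end_height ?q - int t) = (\<Sum>t<?b - ?a. ?f (?a + t))"
  proof (rule sum.cong)
    fix t assume "t \<in> {..<?b - ?a}"
    then have "prefix_min \<sigma> (?a + t) = lr_min \<sigma> (Suc k)"
      by (intro prefix_min_in_block [OF \<sigma>(2) k]) auto
    then show "end_height ?q - int t = ?f (?a + t)"
      by (simp add: top)
  qed simp
  also have "\<dots> = (\<Sum>j=?a..<?b. ?f j)"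
    by (subst sum.atLeastLessThan_shift_0) (simp only: lessThan_atLeast0 comp_def)
  finally have "down_height_sum (path_blocks \<sigma> (Suc k)) = (\<Sum>j<?a. ?f j) + (\<Sum>j=?a..<?b. ?f j)"
    using IH by (simp only: path_blocks_Suc down_height_sum_Downs down_height_sum_Ups gap)
  also have "\<dots> = (\<Sum>j<?b. ?f j)"
    using lt by (simp add: lessThan_atLeast0 sum.atLeastLessThan_concat)
  finally have "down_height_sum (path_blocks \<sigma> (Suc k)) = (\<Sum>j<?b. ?f j)" .
  moreover have "end_height (path_blocks \<sigma> (Suc k))
      = int (length \<sigma>) + 1 - int (lr_min \<sigma> (Suc k)) - int ?b"
    using top lt unfolding path_blocks_Suc end_height_Downs gap by (simp add: of_nat_diff)
  moreover have "int (length (path_blocks \<sigma> (Suc k)))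
      = int (length \<sigma>) + 1 - int (lr_min \<sigma> (Suc k)) + int ?b"
    using IH lt dec by (simp add: path_blocks_Suc gap of_nat_diff)
  ultimately show ?case by blast
qed

lemma Psi_K_profile:
  assumes \<sigma>: "set \<sigma> = {1..length \<sigma>}" "distinct \<sigma>"
  shows "length (Psi_K \<sigma>) = 2 * length \<sigma>"
    and "end_height (Psi_K \<sigma>) = 0"
    and "down_height_sum (Psi_K \<sigma>)
           = (\<Sum>j<length \<sigma>. int (length \<sigma>) + 1 - int (prefix_min \<sigma> j) - int j)"
proof -
  let ?m = "length (lr_min_positions \<sigma>)"
  have "Psi_K \<sigma> = path_blocks \<sigma> ?m"
    by (simp add: Psi_K_def path_blocks_def)
  moreover have "block_start \<sigma> ?m = length \<sigma>"
    by (simp add: block_start_def)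
  ultimately show "length (Psi_K \<sigma>) = 2 * length \<sigma>"
    and "end_height (Psi_K \<sigma>) = 0"
    and "down_height_sum (Psi_K \<sigma>)
           = (\<Sum>j<length \<sigma>. int (length \<sigma>) + 1 - int (prefix_min \<sigma> j) - int j)"
    using path_blocks_profile [OF \<sigma>, of ?m] lr_min_last [OF \<sigma>] by auto
qed

section \<open>Heights and inversions\<close>

text \<open>
  If \<open>\<mu>\<close> is the minimum of the letters up to position \<open>j\<close> and \<open>\<mu> < \<sigma> ! k < \<sigma> ! j\<close> for some
  \<open>k > j\<close>, then \<open>\<mu>\<close> stands before position \<open>j\<close> and the three letters form the pattern 132.
\<close>

lemma above_prefix_min_iff:
  assumes av: "avoids_132 \<sigma>" and dist: "distinct \<sigma>" and jk: "j < k" "k < length \<sigma>"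
  shows "prefix_min \<sigma> j \<le> \<sigma> ! k \<longleftrightarrow> \<sigma> ! j < \<sigma> ! k"
proof
  assume le: "prefix_min \<sigma> j \<le> \<sigma> ! k"
  have jn: "j < length \<sigma>" using jk by simp
  obtain i where i: "i \<le> j" "\<sigma> ! i = prefix_min \<sigma> j"
    using prefix_min_attained [OF jn] .
  have ne: "\<sigma> ! i \<noteq> \<sigma> ! k" "\<sigma> ! j \<noteq> \<sigma> ! k"
    using i jk by (auto simp: nth_eq_iff_index_eq [OF dist])
  show "\<sigma> ! j < \<sigma> ! k"
  proof (rule ccontr)
    assume "\<not> \<sigma> ! j < \<sigma> ! k"
    with ne le i have "\<sigma> ! i < \<sigma> ! k" "\<sigma> ! k < \<sigma> ! j" by auto
    moreover from this i have "i < j" by (cases "i = j") auto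
    ultimately show False
      using av jk unfolding avoids_132_def by blast
  qed
next
  assume "\<sigma> ! j < \<sigma> ! k"
  then show "prefix_min \<sigma> j \<le> \<sigma> ! k"
    using prefix_min_le [of j j \<sigma>] jk by simp
qed

text \<open>
  Both sides count the positions of the letters \<open>\<mu>, \<dots>, n\<close>, where \<open>\<mu>\<close> is the minimum up to
  position \<open>j\<close>: these are all positions up to \<open>j\<close> and the right ends of the non-inversions
  with left end \<open>j\<close>.
\<close>

lemma height_eq_noninversions:
  assumes \<sigma>: "set \<sigma> = {1..length \<sigma>}" "distinct \<sigma>" and av: "avoids_132 \<sigma>" and j: "j < length \<sigma>"
  shows "length \<sigma> + 1 - prefix_min \<sigma> j
           = Suc j + card {k. j < k \<and> k < length \<sigma> \<and> \<sigma> ! j < \<sigma> ! k}"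
proof -
  let ?A = "{k. k < length \<sigma> \<and> prefix_min \<sigma> j \<le> \<sigma> ! k}"
  let ?N = "{k. j < k \<and> k < length \<sigma> \<and> \<sigma> ! j < \<sigma> ! k}"
  obtain i where i: "i \<le> j" "\<sigma> ! i = prefix_min \<sigma> j"
    using prefix_min_attained [OF j] .
  then have pos: "prefix_min \<sigma> j \<ge> 1"
    using \<sigma>(1) j nth_mem [of i \<sigma>] by simp
  have "(!) \<sigma> ` ?A = {x \<in> set \<sigma>. prefix_min \<sigma> j \<le> x}"
    by (auto simp: in_set_conv_nth)
  also have "\<dots> = {prefix_min \<sigma> j..length \<sigma>}"
    using \<sigma>(1) pos by auto
  finally have "card ((!) \<sigma> ` ?A) = length \<sigma> + 1 - prefix_min \<sigma> j" by simp
  moreover have "inj_on ((!) \<sigma>) ?A"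
    by (auto simp: inj_on_def nth_eq_iff_index_eq [OF \<sigma>(2)])
  ultimately have "length \<sigma> + 1 - prefix_min \<sigma> j = card ?A"
    by (simp add: card_image)
  also have "?A = {..j} \<union> ?N"
  proof (rule set_eqI)
    fix k
    show "k \<in> ?A \<longleftrightarrow> k \<in> {..j} \<union> ?N"
      using j prefix_min_le [of k j \<sigma>] above_prefix_min_iff [OF av \<sigma>(2), of j k]
      by (cases "k \<le> j") auto
  qed
  also have "card ({..j} \<union> ?N) = Suc j + card ?N"
    by (subst card_Un_disjoint) auto
  finally show ?thesis .
qed

lemma inv_count_eq_sum:
  "inv_count \<sigma> = (\<Sum>j<length \<sigma>. card {k. j < k \<and> k < length \<sigma> \<and> \<sigma> ! j > \<sigma> ! k})"
proof -
  have "{(i, j). i < j \<and> j < length \<sigma> \<and> \<sigma> ! i > \<sigma> ! j}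
      = (SIGMA j:{..<length \<sigma>}. {k. j < k \<and> k < length \<sigma> \<and> \<sigma> ! j > \<sigma> ! k})"
    by auto
  then show ?thesis
    by (simp add: inv_count_def)
qed

lemma noninversions_plus_inversions:
  fixes \<sigma> :: "'a :: linorder list"
  assumes dist: "distinct \<sigma>" and j: "j < length \<sigma>"
  shows "Suc j + card {k. j < k \<and> k < length \<sigma> \<and> \<sigma> ! j < \<sigma> ! k}
           + card {k. j < k \<and> k < length \<sigma> \<and> \<sigma> ! j > \<sigma> ! k} = length \<sigma>"
proof -
  let ?N = "{k. j < k \<and> k < length \<sigma> \<and> \<sigma> ! j < \<sigma> ! k}"
  let ?I = "{k. j < k \<and> k < length \<sigma> \<and> \<sigma> ! j > \<sigma> ! k}"
  have "card ?N + card ?I = card (?N \<union> ?I)"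
    by (subst card_Un_disjoint) auto
  also have "?N \<union> ?I = {j<..<length \<sigma>}"
  proof -
    have "\<sigma> ! j < \<sigma> ! k \<or> \<sigma> ! j > \<sigma> ! k" if "j < k" "k < length \<sigma>" for k
      using nth_eq_iff_index_eq [OF dist j that(2)] that by (simp add: neq_iff)
    then show ?thesis by (simp add: set_eq_iff) blast
  qed
  finally show ?thesis
    using j by simp
qed

lemma sum_down_from: "(\<Sum>j<n. int n - int j) = int ((n + 1) choose 2)"
proof -
  have "(\<Sum>j<n. int n - int j) = (\<Sum>j<n. int (Suc j))"
    by (subst sum.nat_diff_reindex [symmetric]) (auto intro: sum.cong)
  also have "\<dots> = int ((n + 1) choose 2)"
    by (induction n) (simp_all add: numeral_2_eq_2)
  finally show ?thesis .
qed

lemma down_height_sum_Psi_K: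
  assumes \<sigma>: "set \<sigma> = {1..length \<sigma>}" "distinct \<sigma>" and av: "avoids_132 \<sigma>"
  shows "down_height_sum (Psi_K \<sigma>) = int ((length \<sigma> + 1) choose 2) - int (inv_count \<sigma>)"
proof -
  let ?n = "length \<sigma>"
  let ?I = "\<lambda>j. card {k. j < k \<and> k < ?n \<and> \<sigma> ! j > \<sigma> ! k}"
  have "int ?n + 1 - int (prefix_min \<sigma> j) - int j = (int ?n - int j) - int (?I j)" if "j < ?n" for j
    using height_eq_noninversions [OF \<sigma> av that] noninversions_plus_inversions [OF \<sigma>(2) that]
    by linarith
  then have "down_height_sum (Psi_K \<sigma>) = (\<Sum>j<?n. (int ?n - int j) - int (?I j))"
    unfolding Psi_K_profile(3) [OF \<sigma>] by (intro sum.cong) auto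
  also have "\<dots> = (\<Sum>j<?n. int ?n - int j) - (\<Sum>j<?n. int (?I j))"
    by (rule sum_subtractf)
  also have "\<dots> = int ((?n + 1) choose 2) - int (inv_count \<sigma>)"
    by (simp only: sum_down_from inv_count_eq_sum of_nat_sum)
  finally show ?thesis .
qed

theorem corollary3p4:
  fixes n :: nat and \<pi> :: "nat list"
  assumes "\<pi> \<in> S132 n"
  shows "(\<Sum>i=1..2*n. start_height (Psi_K \<pi>) i) = (int n)^2 - 2 * int (inv_count \<pi>)
    \<and> (\<Sum>i\<in>down_indices (Psi_K \<pi>). start_height (Psi_K \<pi>) i)
           = int ((n + 1) choose 2) - int (inv_count \<pi>)"
proof -
  have perm: "set \<pi> = {1..n}" "distinct \<pi>" and av: "avoids_132 \<pi>"
    using assms by (auto simp: S132_def permutations_of_set_def)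
  have n: "length \<pi> = n"
    using distinct_card [OF perm(2)] perm(1) by simp
  note \<pi> = perm [folded n]
  have down: "down_height_sum (Psi_K \<pi>) = int ((n + 1) choose 2) - int (inv_count \<pi>)"
    using down_height_sum_Psi_K [OF \<pi> av] n by simp
  have "2 * height_sum (Psi_K \<pi>) - 4 * down_height_sum (Psi_K \<pi>) + 2 * int n = 0"
    using end_height_square [of "Psi_K \<pi>"] Psi_K_profile(1,2) [OF \<pi>] n by simp
  moreover have "2 * int ((n + 1) choose 2) = int n * (int n + 1)"
    by (induction n) (simp_all add: numeral_2_eq_2 algebra_simps)
  ultimately have "height_sum (Psi_K \<pi>) = (int n)^2 - 2 * int (inv_count \<pi>)"
    using down by (simp add: power2_eq_square algebra_simps)
  then show ?thesis
    using down Psi_K_profile(1) [OF \<pi>] n by (simp add: height_sum_def down_height_sum_def)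
qed

end
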